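(* Let $f\colon P\to Q$ be a surjective quandle homomorphism and let $N=\mathrm{Trans}_{\mathrm{rel}}(f)$. Then $f$ decomposes as $f=h_N\circ\pi_N$, where the quotient map $\pi_N\colon P\to P/N$ is connected and the induced homomorphism $h_N\colon P/N\to Q$ is a covering homomorphism. Moreover, this decomposition is universal among all factorizations of $f$ with the second morphism a covering homomorphism: if $f=h\circ\pi$ with $\pi\colon P\to R$ a quandle homomorphism and $h\colon R\to Q$ a covering homomorphism, then there exists a unique quandle homomorphism $u\colon P/N\to R$ such that $\pi=u\circ\pi_N$ and $h_N=h\circ u$.
   Context: A quandle is a set $Q$ with bijections $s_x\colon Q\to Q$ ($x\in Q$) such that $s_x(x)=x$ and $s_x\circ s_y=s_{s_x(y)}\circ s_x$ for all $x,y\in Q$. A quandle homomorphism $f\colon P\to Q$ is a map with $f(s_x(y))=s_{f(x)}(f(y))$ for all $x,y\in P$. The inner automorphism group $\mathrm{Inn}(P)$ is the group of permutations of $P$ generated by all $s_x$, $x\in P$. A surjective quandle homomorphism $f\colon P\to Q$ induces a surjective group homomorphism $f_*\colon\mathrm{Inn}(P)\to\mathrm{Inn}(Q)$, where $f_*(\varphi)$ is the unique element of $\mathrm{Inn}(Q)$ with $f\circ\varphi=f_*(\varphi)\circ f$. Put $\mathrm{Inn}_{\mathrm{rel}}(f)=\ker(f_* )$; it preserves each fiber of $f$. The homomorphism $f$ is connected if it is surjective and for each $q\in Q$ the group $\mathrm{Inn}_{\mathrm{rel}}(f)$ acts transitively on $f^{-1}(q)$. The relative transvection group of $f$ is $\mathrm{Trans}_{\mathrm{rel}}(f)=\langle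 s_xs_y^{-1}\mid x,y\in P,\ f(x)=f(y)\rangle$, a normal subgroup of $\mathrm{Inn}(P)$ contained in $\mathrm{Inn}_{\mathrm{rel}}(f)$. A quandle homomorphism $h\colon R\to Q$ is covering if it is surjective and $h(x)=h(y)$ implies $s_x=s_y$ for all $x,y\in R$. For a normal subgroup $N$ of $\mathrm{Inn}(P)$, $P/N$ denotes the set of $N$-orbits in $P$ with the (well-defined) quandle structure $s_{[x]}([y])=[s_x(y)]$, and $\pi_N\colon P\to P/N$ is the natural quotient homomorphism. When $N\subseteq \mathrm{Inn}_{\mathrm{rel}}(f)$, the induced homomorphism $h_N\colon P/N\to Q$ is $[x]\mapsto f(x)$. *)

theory Defs
  imports "HOL-Algebra.Group_Action" "HOL-Algebra.Generated_Groups"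
begin

section \<open>Quandles and their homomorphisms\<close>

text \<open>The field \<open>psym\<close> (point symmetry) is the family of maps: \<open>psym P x\<close> stands for $s_x$. Its
  values outside of the carrier are irrelevant.\<close>

record 'a quandle = "'a partial_object" +
  psym :: "'a \<Rightarrow> 'a \<Rightarrow> 'a"

locale quandle =
  fixes P :: "'a quandle"
  assumes psym_bij: "x \<in> carrier P \<Longrightarrow> bij_betw (psym P x) (carrier P) (carrier P)"
    and psym_self: "x \<in> carrier P \<Longrightarrow> psym P x x = x"
    and psym_distrib: "\<lbrakk>x \<in> carrier P; y \<in> carrier P; z \<in> carrier P\<rbrakk>
      \<Longrightarrow> psym P x (psym P y z) = psym P (psym P x y) (psym P x z)"

locale quandle_hom =
  dom: quandle P + cod: quandle Q for P :: "'a quandle" and Q :: "'b quandle" +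
  fixes f :: "'a \<Rightarrow> 'b"
  assumes hom_closed: "x \<in> carrier P \<Longrightarrow> f x \<in> carrier Q"
    and hom_psym: "\<lbrakk>x \<in> carrier P; y \<in> carrier P\<rbrakk> \<Longrightarrow> f (psym P x y) = psym Q (f x) (f y)"

section \<open>Inner automorphism groups\<close>

text \<open>\<open>s\<^sub>x\<close> as an element of the group of permutations of the carrier, which in
  \<^const>\<open>BijGroup\<close> consists of extensional functions.\<close>

definition psym_perm :: "'a quandle \<Rightarrow> 'a \<Rightarrow> 'a \<Rightarrow> 'a" where
  "psym_perm P x = restrict (psym P x) (carrier P)"

definition Inn :: "'a quandle \<Rightarrow> ('a \<Rightarrow> 'a) monoid" where
  "Inn P = subgroup_generated (BijGroup (carrier P)) (psym_perm P ` carrier P)"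

text \<open>The homomorphism \<open>f\<^sub>*\<close> on inner automorphism groups; see \<open>induced_Inn_ex1\<close> below for
  existence and uniqueness.\<close>

definition induced_Inn ::
  "'a quandle \<Rightarrow> 'b quandle \<Rightarrow> ('a \<Rightarrow> 'b) \<Rightarrow> ('a \<Rightarrow> 'a) \<Rightarrow> ('b \<Rightarrow> 'b)" where
  "induced_Inn P Q f \<phi> =
    (THE \<psi>. \<psi> \<in> carrier (Inn Q) \<and> (\<forall>x\<in>carrier P. f (\<phi> x) = \<psi> (f x)))"

definition Inn_rel :: "'a quandle \<Rightarrow> 'b quandle \<Rightarrow> ('a \<Rightarrow> 'b) \<Rightarrow> ('a \<Rightarrow> 'a) set" where
  "Inn_rel P Q f = kernel (Inn P) (Inn Q) (induced_Inn P Q f)"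

definition Trans_rel :: "'a quandle \<Rightarrow> ('a \<Rightarrow> 'b) \<Rightarrow> ('a \<Rightarrow> 'a) set" where
  "Trans_rel P f = generate (Inn P)
    {psym_perm P x \<otimes>\<^bsub>Inn P\<^esub> inv\<^bsub>Inn P\<^esub> (psym_perm P y) | x y.
      x \<in> carrier P \<and> y \<in> carrier P \<and> f x = f y}"

section \<open>Connected and covering homomorphisms\<close>

definition connected_hom :: "'a quandle \<Rightarrow> 'b quandle \<Rightarrow> ('a \<Rightarrow> 'b) \<Rightarrow> bool" where
  "connected_hom P Q f \<longleftrightarrow> quandle_hom P Q f \<and> f ` carrier P = carrier Q \<and>
    (\<forall>q\<in>carrier Q. \<forall>x\<in>carrier P. \<forall>y\<in>carrier P.
      f x = q \<and> f y = q \<longrightarrow> (\<exists>\<phi>\<in>Inn_rel P Q f. \<phi> x = y))"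

definition covering_hom :: "'a quandle \<Rightarrow> 'b quandle \<Rightarrow> ('a \<Rightarrow> 'b) \<Rightarrow> bool" where
  "covering_hom R Q h \<longleftrightarrow> quandle_hom R Q h \<and> h ` carrier R = carrier Q \<and>
    (\<forall>x\<in>carrier R. \<forall>y\<in>carrier R. h x = h y \<longrightarrow> psym_perm R x = psym_perm R y)"

section \<open>Quotients by normal subgroups of the inner automorphism group\<close>

text \<open>The natural quotient map \<open>\<pi>\<^sub>N\<close>, sending a point to its \<open>N\<close>-orbit.\<close>

definition quot_map :: "'a quandle \<Rightarrow> ('a \<Rightarrow> 'a) set \<Rightarrow> 'a \<Rightarrow> 'a set" where
  "quot_map P N x = orbit (Inn P\<lparr>carrier := N\<rparr>) (\<lambda>\<phi>. \<phi>) x"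

text \<open>The quotient structure does not depend on the representatives, see \<open>psym_quot_quandle\<close>.\<close>

definition quot_quandle :: "'a quandle \<Rightarrow> ('a \<Rightarrow> 'a) set \<Rightarrow> 'a set quandle" where
  "quot_quandle P N =
    \<lparr>carrier = orbits (Inn P\<lparr>carrier := N\<rparr>) (carrier P) (\<lambda>\<phi>. \<phi>),
     psym = \<lambda>X Y. THE Z. \<forall>x\<in>X. \<forall>y\<in>Y. Z = quot_map P N (psym P x y)\<rparr>"

text \<open>The induced map \<open>h\<^sub>N\<close>, sending \<open>[x]\<close> to \<open>f x\<close>; \<open>f\<close> is constant on each orbit when
  \<open>N\<close> is contained in \<^term>\<open>Inn_rel P Q f\<close>.\<close>

definition quot_induced :: "('a \<Rightarrow> 'b) \<Rightarrow> 'a set \<Rightarrow> 'b" where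
  "quot_induced f X = the_elem (f ` X)"

section \<open>Well-definedness\<close>

context quandle
begin

abbreviation "Bij_grp \<equiv> BijGroup (carrier P)"

lemma psym_perm_in_Bij_grp: "psym_perm P ` carrier P \<subseteq> carrier Bij_grp"
  using psym_bij by (auto simp: BijGroup_def Bij_def psym_perm_def cong: bij_betw_cong)

lemma carrier_Inn: "carrier (Inn P) = generate Bij_grp (psym_perm P ` carrier P)"
  using psym_perm_in_Bij_grp by (simp add: Inn_def carrier_subgroup_generated inf_absorb2)

lemma group_Inn: "group (Inn P)"
  by (simp add: Inn_def group.group_subgroup_generated group_BijGroup)

lemma Inn_subset: "carrier (Inn P) \<subseteq> Bij (carrier P)"
  using group.generate_incl[OF group_BijGroup psym_perm_in_Bij_grp]
  by (simp add: carrier_Inn) (simp add: BijGroup_def)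

lemma psym_perm_apply: "y \<in> carrier P \<Longrightarrow> psym_perm P x y = psym P x y"
  by (simp add: psym_perm_def)

lemma psym_perm_Inn: "x \<in> carrier P \<Longrightarrow> psym_perm P x \<in> carrier (Inn P)"
  by (simp add: carrier_Inn generate.incl)

lemma Inn_closed: "\<lbrakk>\<phi> \<in> carrier (Inn P); x \<in> carrier P\<rbrakk> \<Longrightarrow> \<phi> x \<in> carrier P"
  using Inn_subset by (auto simp: Bij_def bij_betw_def)

lemma Inn_one: "x \<in> carrier P \<Longrightarrow> \<one>\<^bsub>Inn P\<^esub> x = x"
  by (simp add: Inn_def) (simp add: BijGroup_def)

lemma Bij_grp_mult: "\<lbrakk>\<phi> \<in> carrier Bij_grp; \<psi> \<in> carrier Bij_grp; x \<in> carrier P\<rbrakk> \<Longrightarrow> (\<phi> \<otimes>\<^bsub>Bij_grp\<^esub> \<psi>) x = \<phi> (\<psi> x)"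
  by (simp add: BijGroup_def compose_eq)

lemma Inn_mult:
  "\<lbrakk>\<phi> \<in> carrier (Inn P); \<psi> \<in> carrier (Inn P); x \<in> carrier P\<rbrakk> \<Longrightarrow> (\<phi> \<otimes>\<^bsub>Inn P\<^esub> \<psi>) x = \<phi> (\<psi> x)"
  using Bij_grp_mult Inn_subset by (simp add: Inn_def) (auto simp: BijGroup_def)

lemma Inn_inv_left: "\<lbrakk>\<phi> \<in> carrier (Inn P); x \<in> carrier P\<rbrakk> \<Longrightarrow> (inv\<^bsub>Inn P\<^esub> \<phi>) (\<phi> x) = x"
  using Inn_mult[of "inv\<^bsub>Inn P\<^esub> \<phi>" \<phi> x] Inn_one group_Inn
  by (simp add: group.l_inv group.inv_closed)

lemma Inn_inv_right: "\<lbrakk>\<phi> \<in> carrier (Inn P); x \<in> carrier P\<rbrakk> \<Longrightarrow> \<phi> ((inv\<^bsub>Inn P\<^esub> \<phi>) x) = x"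
  using Inn_mult[of \<phi> "inv\<^bsub>Inn P\<^esub> \<phi>" x] Inn_one group_Inn
  by (simp add: group.r_inv group.inv_closed)

lemma Inn_ext:
  assumes "\<phi> \<in> carrier (Inn P)" "\<psi> \<in> carrier (Inn P)" "\<And>x. x \<in> carrier P \<Longrightarrow> \<phi> x = \<psi> x"
  shows "\<phi> = \<psi>"
  using assms Inn_subset by (intro extensionalityI[of _ "carrier P"]) (auto simp: Bij_def)

lemma Inn_induct [consumes 1, case_names one psym inv mult]:
  assumes "\<phi> \<in> carrier (Inn P)"
    and "A \<one>\<^bsub>Inn P\<^esub>"
    and "\<And>x. x \<in> carrier P \<Longrightarrow> A (psym_perm P x)"
    and "\<And>\<phi>. \<lbrakk>\<phi> \<in> carrier (Inn P); A \<phi>\<rbrakk> \<Longrightarrow> A (inv\<^bsub>Inn P\<^esub> \<phi>)"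
    and "\<And>\<phi> \<psi>. \<lbrakk>\<phi> \<in> carrier (Inn P); \<psi> \<in> carrier (Inn P); A \<phi>; A \<psi>\<rbrakk> \<Longrightarrow> A (\<phi> \<otimes>\<^bsub>Inn P\<^esub> \<psi>)"
  shows "A \<phi>"
proof -
  have inv_eq: "inv\<^bsub>Inn P\<^esub> h = inv\<^bsub>Bij_grp\<^esub> h" if "h \<in> carrier (Inn P)" for h
    using that group.inv_subgroup_generated[OF group_BijGroup] by (simp add: Inn_def)
  have "\<phi> \<in> generate Bij_grp (psym_perm P ` carrier P)"
    using assms(1) carrier_Inn by simp
  then show ?thesis
  proof (induction rule: generate.induct)
    case one
    then show ?case using assms(2) by (simp add: Inn_def)
  next
    case (incl h)
    then show ?case using assms(3) by auto
  next
    case (inv h)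
    then obtain x where x: "x \<in> carrier P" "h = psym_perm P x" by blast
    then show ?case using assms(4)[OF psym_perm_Inn assms(3)] inv_eq[OF psym_perm_Inn] by simp
  next
    case (eng h1 h2)
    then show ?case using assms(5)[of h1 h2] carrier_Inn by (simp add: Inn_def)
  qed
qed

lemma psym_closed: "\<lbrakk>x \<in> carrier P; y \<in> carrier P\<rbrakk> \<Longrightarrow> psym P x y \<in> carrier P"
  using psym_bij bij_betwE by blast

lemma Inn_psym:
  assumes "\<phi> \<in> carrier (Inn P)" "x \<in> carrier P" "y \<in> carrier P"
  shows "\<phi> (psym P x y) = psym P (\<phi> x) (\<phi> y)"
  using assms
proof (induction arbitrary: x y rule: Inn_induct)
  case one
  then show ?case by (simp add: Inn_one psym_closed)
next
  case (psym z)
  then show ?case using psym_distrib[of z x y] by (simp add: psym_perm_apply psym_closed)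
next
  case (inv \<phi>)
  have i: "inv\<^bsub>Inn P\<^esub> \<phi> \<in> carrier (Inn P)"
    using inv(1) group_Inn by (simp add: group.inv_closed)
  let ?x = "(inv\<^bsub>Inn P\<^esub> \<phi>) x" and ?y = "(inv\<^bsub>Inn P\<^esub> \<phi>) y"
  have c: "?x \<in> carrier P" "?y \<in> carrier P" using i inv(3,4) Inn_closed by auto
  have "\<phi> (psym P ?x ?y) = psym P x y"
    using inv(2)[OF c] Inn_inv_right[OF inv(1) inv(3)] Inn_inv_right[OF inv(1) inv(4)] by simp
  then show ?case using Inn_inv_left[OF inv(1) psym_closed[OF c]] by simp
next
  case (mult \<phi> \<psi>)
  then show ?case by (simp add: Inn_mult psym_closed Inn_closed)
qed

lemma Inn_conj:
  assumes \<phi>: "\<phi> \<in> carrier (Inn P)" and x: "x \<in> carrier P"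
  shows "\<phi> \<otimes>\<^bsub>Inn P\<^esub> psym_perm P x \<otimes>\<^bsub>Inn P\<^esub> inv\<^bsub>Inn P\<^esub> \<phi> = psym_perm P (\<phi> x)"
proof -
  interpret I: group "Inn P" by (rule group_Inn)
  have "\<phi> \<otimes>\<^bsub>Inn P\<^esub> psym_perm P x = psym_perm P (\<phi> x) \<otimes>\<^bsub>Inn P\<^esub> \<phi>"
    using \<phi> x by (intro Inn_ext)
      (auto simp: Inn_mult psym_perm_Inn Inn_closed Inn_psym psym_perm_apply)
  then show ?thesis
    using \<phi> x by (simp add: I.m_assoc psym_perm_Inn Inn_closed)
qed

lemma mem_quot_map: "z \<in> quot_map P N x \<longleftrightarrow> (\<exists>n\<in>N. z = n x)"
  by (auto simp: quot_map_def orbit_def)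

lemma quot_map_eqI:
  assumes N: "N \<lhd> Inn P" and n: "n \<in> N" and x: "x \<in> carrier P"
  shows "quot_map P N (n x) = quot_map P N x"
proof -
  interpret N: normal N "Inn P" by fact
  have m: "m \<in> carrier (Inn P)" if "m \<in> N" for m using that N.subset by auto
  have 1: "m (n x) = (m \<otimes>\<^bsub>Inn P\<^esub> n) x" "m \<otimes>\<^bsub>Inn P\<^esub> n \<in> N" if "m \<in> N" for m
    using that n x by (auto simp: Inn_mult m)
  have 2: "m x = (m \<otimes>\<^bsub>Inn P\<^esub> inv\<^bsub>Inn P\<^esub> n) (n x)" "m \<otimes>\<^bsub>Inn P\<^esub> inv\<^bsub>Inn P\<^esub> n \<in> N" if "m \<in> N" for m
    using that n x by (auto simp: Inn_mult m Inn_closed Inn_inv_left)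
  show ?thesis
  proof
    show "quot_map P N (n x) \<subseteq> quot_map P N x"
    proof
      fix z assume "z \<in> quot_map P N (n x)"
      then obtain m where "m \<in> N" "z = m (n x)" by (auto simp: mem_quot_map)
      then show "z \<in> quot_map P N x" using 1[of m] mem_quot_map by metis
    qed
    show "quot_map P N x \<subseteq> quot_map P N (n x)"
    proof
      fix z assume "z \<in> quot_map P N x"
      then obtain m where "m \<in> N" "z = m x" by (auto simp: mem_quot_map)
      then show "z \<in> quot_map P N (n x)" using 2[of m] mem_quot_map by metis
    qed
  qed
qed

lemma psym_quot_quandle:
  assumes N: "N \<lhd> Inn P" and x: "x \<in> carrier P" and y: "y \<in> carrier P"
  shows "psym (quot_quandle P N) (quot_map P N x) (quot_map P N y) = quot_map P N (psym P x y)"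
proof -
  interpret N: normal N "Inn P" by fact
  note cl = psym_closed
  have m: "m \<in> carrier (Inn P)" if "m \<in> N" for m using that N.subset by auto
  have self: "z \<in> quot_map P N z" if "z \<in> carrier P" for z
    using subgroup.one_closed[OF N.subgroup_axioms] Inn_one[OF that]
    by (auto simp: mem_quot_map intro!: bexI[of _ "\<one>\<^bsub>Inn P\<^esub>"])
  have step: "quot_map P N (psym P (n x) (k y)) = quot_map P N (psym P x y)"
    if n: "n \<in> N" and k: "k \<in> N" for n k
  proof -
    let ?i = "inv\<^bsub>Inn P\<^esub> n" and ?s = "psym_perm P x"
    let ?l = "?i \<otimes>\<^bsub>Inn P\<^esub> k"
    have l: "?l \<in> N" and i: "?i \<in> N" using n k by auto
    let ?c = "?s \<otimes>\<^bsub>Inn P\<^esub> ?l \<otimes>\<^bsub>Inn P\<^esub> inv\<^bsub>Inn P\<^esub> ?s"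
    have c: "?c \<in> N" using N.inv_op_closed2 l psym_perm_Inn[OF x] by blast
    have "psym P (n x) (k y) = n (psym P x (?l y))"
      using n k x y m[OF n] m[OF k] m[OF i]
      by (simp add: Inn_psym Inn_mult Inn_closed Inn_inv_right)
    moreover have "psym P x (?l y) = ?c (psym P x y)"
      using x y m[OF l] Inn_inv_left[OF psym_perm_Inn[OF x] y] psym_perm_Inn[OF x]
      by (simp add: Inn_mult group.inv_closed group_Inn cl Inn_closed psym_perm_apply)
    ultimately show ?thesis
      using quot_map_eqI[OF N n] quot_map_eqI[OF N c] x y m[OF l] cl Inn_closed by metis
  qed
  show ?thesis
    unfolding quot_quandle_def
  proof (simp, rule the_equality)
    show "\<forall>x'\<in>quot_map P N x. \<forall>y'\<in>quot_map P N y.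
      quot_map P N (psym P x y) = quot_map P N (psym P x' y')"
    proof (intro ballI)
      fix x' y' assume "x' \<in> quot_map P N x" "y' \<in> quot_map P N y"
      then obtain n k where "n \<in> N" "x' = n x" "k \<in> N" "y' = k y" unfolding mem_quot_map by blast
      then show "quot_map P N (psym P x y) = quot_map P N (psym P x' y')" using step by simp
    qed
  qed (use self[OF x] self[OF y] in blast)
qed

end

context quandle_hom
begin

lemma induced_Inn_ex1:
  assumes surj: "f ` carrier P = carrier Q" and "\<phi> \<in> carrier (Inn P)"
  shows "\<exists>!\<psi>. \<psi> \<in> carrier (Inn Q) \<and> (\<forall>x\<in>carrier P. f (\<phi> x) = \<psi> (f x))"
proof -
  interpret G: group "Inn Q" by (rule cod.group_Inn)
  interpret H: group "Inn P" by (rule dom.group_Inn)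
  have "\<exists>\<psi>. \<psi> \<in> carrier (Inn Q) \<and> (\<forall>x\<in>carrier P. f (\<phi> x) = \<psi> (f x))"
    using assms(2)
  proof (induction rule: dom.Inn_induct)
    case one
    show ?case
      by (rule exI[of _ "\<one>\<^bsub>Inn Q\<^esub>"]) (simp add: dom.Inn_one cod.Inn_one hom_closed)
  next
    case (psym x)
    then show ?case
      by (intro exI[of _ "psym_perm Q (f x)"])
        (simp add: cod.psym_perm_Inn hom_closed cod.psym_perm_apply dom.psym_perm_apply hom_psym)
  next
    case (inv \<phi>)
    then obtain \<psi> where \<psi>: "\<psi> \<in> carrier (Inn Q)" "\<forall>x\<in>carrier P. f (\<phi> x) = \<psi> (f x)" by blast
    have "f ((inv\<^bsub>Inn P\<^esub> \<phi>) x) = (inv\<^bsub>Inn Q\<^esub> \<psi>) (f x)" if x: "x \<in> carrier P" for x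
    proof -
      have c: "(inv\<^bsub>Inn P\<^esub> \<phi>) x \<in> carrier P" using inv x by (simp add: dom.Inn_closed)
      then have "\<psi> (f ((inv\<^bsub>Inn P\<^esub> \<phi>) x)) = f x"
        using \<psi>(2) dom.Inn_inv_right[OF inv(1) x] by metis
      then show ?thesis using cod.Inn_inv_left[OF \<psi>(1) hom_closed[OF c]] by simp
    qed
    then show ?case using \<psi>(1) G.inv_closed by blast
  next
    case (mult \<phi>1 \<phi>2)
    then obtain \<psi>1 \<psi>2 where
      "\<psi>1 \<in> carrier (Inn Q)" "\<forall>x\<in>carrier P. f (\<phi>1 x) = \<psi>1 (f x)"
      "\<psi>2 \<in> carrier (Inn Q)" "\<forall>x\<in>carrier P. f (\<phi>2 x) = \<psi>2 (f x)" by blast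
    then show ?case using mult
      by (intro exI[of _ "\<psi>1 \<otimes>\<^bsub>Inn Q\<^esub> \<psi>2"])
        (simp add: dom.Inn_mult cod.Inn_mult dom.Inn_closed hom_closed)
  qed
  then show ?thesis
  proof (rule ex_ex1I)
    fix \<psi> \<psi>'
    assume "\<psi> \<in> carrier (Inn Q) \<and> (\<forall>x\<in>carrier P. f (\<phi> x) = \<psi> (f x))"
      and "\<psi>' \<in> carrier (Inn Q) \<and> (\<forall>x\<in>carrier P. f (\<phi> x) = \<psi>' (f x))"
    then show "\<psi> = \<psi>'"
      by (intro cod.Inn_ext) (auto simp: surj[symmetric])
  qed
qed

lemma Inn_rel_iff:
  assumes surj: "f ` carrier P = carrier Q"
  shows "\<phi> \<in> Inn_rel P Q f \<longleftrightarrow> \<phi> \<in> carrier (Inn P) \<and> (\<forall>x\<in>carrier P. f (\<phi> x) = f x)"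
proof (cases "\<phi> \<in> carrier (Inn P)")
  case True
  interpret G: group "Inn Q" by (rule cod.group_Inn)
  note ex1 = induced_Inn_ex1[OF surj True]
  have spec: "\<forall>x\<in>carrier P. f (\<phi> x) = induced_Inn P Q f \<phi> (f x)"
    using theI'[OF ex1] by (simp add: induced_Inn_def)
  have "induced_Inn P Q f \<phi> = \<one>\<^bsub>Inn Q\<^esub>" if "\<forall>x\<in>carrier P. f (\<phi> x) = f x"
    unfolding induced_Inn_def using that
    by (intro the1_equality[OF ex1]) (simp add: cod.Inn_one hom_closed)
  then show ?thesis
    using True spec by (auto simp: Inn_rel_def kernel_def cod.Inn_one hom_closed)
qed (simp add: Inn_rel_def kernel_def)

lemma Trans_rel_subset_Inn_rel:
  assumes surj: "f ` carrier P = carrier Q"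
  shows "Trans_rel P f \<subseteq> Inn_rel P Q f"
proof
  interpret H: group "Inn P" by (rule dom.group_Inn)
  have inv_fix: "f ((inv\<^bsub>Inn P\<^esub> g) x) = f x"
    if g: "g \<in> carrier (Inn P)" "\<And>x. x \<in> carrier P \<Longrightarrow> f (g x) = f x" and x: "x \<in> carrier P" for g x
    using g(2)[of "(inv\<^bsub>Inn P\<^esub> g) x"] g x by (simp add: dom.Inn_closed dom.Inn_inv_right)
  have gen: "f ((psym_perm P a \<otimes>\<^bsub>Inn P\<^esub> inv\<^bsub>Inn P\<^esub> (psym_perm P b)) x) = f x"
    if a: "a \<in> carrier P" and b: "b \<in> carrier P" and ab: "f a = f b" and x: "x \<in> carrier P" for a b x
  proof -
    let ?y = "(inv\<^bsub>Inn P\<^esub> (psym_perm P b)) x"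
    have y: "?y \<in> carrier P" using b x by (simp add: dom.Inn_closed dom.psym_perm_Inn)
    have "f (psym_perm P a ?y) = f (psym_perm P b ?y)"
      using a b ab y by (simp add: psym_perm_def hom_psym)
    then show ?thesis
      using a b x by (simp add: dom.Inn_mult dom.psym_perm_Inn dom.Inn_inv_right)
  qed
  fix \<phi> assume "\<phi> \<in> Trans_rel P f"
  then have "\<phi> \<in> carrier (Inn P) \<and> (\<forall>x\<in>carrier P. f (\<phi> x) = f x)"
    unfolding Trans_rel_def
  proof (induction rule: generate.induct)
    case one
    then show ?case by (simp add: dom.Inn_one)
  next
    case (incl h)
    then show ?case using gen dom.psym_perm_Inn by auto
  next
    case (inv h)
    then have "h \<in> carrier (Inn P)" "\<And>x. x \<in> carrier P \<Longrightarrow> f (h x) = f x"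
      using gen dom.psym_perm_Inn by auto
    then show ?case using inv_fix by simp
  next
    case (eng h1 h2)
    then show ?case by (simp add: dom.Inn_mult dom.Inn_closed)
  qed
  then show "\<phi> \<in> Inn_rel P Q f" unfolding Inn_rel_iff[OF surj] .
qed

lemma Trans_rel_normal:
  assumes surj: "f ` carrier P = carrier Q"
  shows "Trans_rel P f \<lhd> Inn P"
  unfolding Trans_rel_def
proof (rule group.normal_generateI[OF dom.group_Inn])
  interpret H: group "Inn P" by (rule dom.group_Inn)
  let ?S = "{psym_perm P x \<otimes>\<^bsub>Inn P\<^esub> inv\<^bsub>Inn P\<^esub> (psym_perm P y) | x y.
      x \<in> carrier P \<and> y \<in> carrier P \<and> f x = f y}"
  show "?S \<subseteq> carrier (Inn P)" using dom.psym_perm_Inn by auto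
  fix h g assume h: "h \<in> ?S" and g: "g \<in> carrier (Inn P)"
  then obtain x y where xy: "x \<in> carrier P" "y \<in> carrier P" "f x = f y"
    and h: "h = psym_perm P x \<otimes>\<^bsub>Inn P\<^esub> inv\<^bsub>Inn P\<^esub> (psym_perm P y)" by blast
  let ?s = "psym_perm P x" and ?t = "psym_perm P y"
  have st: "?s \<in> carrier (Inn P)" "?t \<in> carrier (Inn P)" using xy dom.psym_perm_Inn by auto
  obtain \<psi> where "\<forall>x\<in>carrier P. f (g x) = \<psi> (f x)"
    using induced_Inn_ex1[OF surj g] by blast
  then have "f (g x) = f (g y)" using xy by simp
  moreover have "g \<otimes>\<^bsub>Inn P\<^esub> h \<otimes>\<^bsub>Inn P\<^esub> inv\<^bsub>Inn P\<^esub> g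
      = psym_perm P (g x) \<otimes>\<^bsub>Inn P\<^esub> inv\<^bsub>Inn P\<^esub> (psym_perm P (g y))"
  proof -
    have "inv\<^bsub>Inn P\<^esub> g \<otimes>\<^bsub>Inn P\<^esub> (g \<otimes>\<^bsub>Inn P\<^esub> z) = z" if "z \<in> carrier (Inn P)" for z
      using g that by (simp add: H.m_assoc[symmetric])
    then show ?thesis
      unfolding dom.Inn_conj[OF g xy(1), symmetric] dom.Inn_conj[OF g xy(2), symmetric] h
      using g st by (simp add: H.inv_mult_group H.m_assoc)
  qed
  ultimately show "g \<otimes>\<^bsub>Inn P\<^esub> h \<otimes>\<^bsub>Inn P\<^esub> inv\<^bsub>Inn P\<^esub> g \<in> ?S"
    using dom.Inn_closed[OF g xy(1)] dom.Inn_closed[OF g xy(2)]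
    by (intro CollectI exI[of _ "g x"] exI[of _ "g y"]) simp
qed

end

end

theory Submission
  imports Defs
begin

text \<open>A map is constant on the orbits of \<open>N = Trans\<^sub>r\<^sub>e\<^sub>l(f)\<close> as soon as the generators
  \<open>s\<^sub>x s\<^sub>y\<inverse>\<close> with \<open>f x = f y\<close> do not move its values. For a homomorphism \<open>\<pi>\<close> this holds
  whenever \<open>f x = f y\<close> forces the point symmetries at \<open>\<pi> x\<close> and \<open>\<pi> y\<close> to agree, which is what
  a factorization of \<open>f\<close> through a covering provides; hence such a \<open>\<pi>\<close> descends to \<open>P/N\<close>.
  Conversely, in \<open>P/N\<close> the points \<open>s\<^sub>x z\<close> and \<open>s\<^sub>y z\<close> are identified whenever \<open>f x = f y\<close>,
  so \<open>h\<^sub>N\<close> is a covering.\<close>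

section \<open>Quotients by an arbitrary normal subgroup of \<open>Inn P\<close>\<close>

lemma carrier_quot_quandle: "carrier (quot_quandle P N) = quot_map P N ` carrier P"
  by (auto simp: quot_quandle_def orbits_def quot_map_def)

context quandle
begin

lemma quot_map_self:
  assumes "N \<lhd> Inn P" and "x \<in> carrier P"
  shows "x \<in> quot_map P N x"
proof -
  have "\<one>\<^bsub>Inn P\<^esub> \<in> N"
    using assms(1) by (simp add: normal_imp_subgroup subgroup.one_closed)
  then show ?thesis
    using Inn_one[OF assms(2)] mem_quot_map by metis
qed

lemma normal_Inn_closed:
  assumes "N \<lhd> Inn P" and "n \<in> N"
  shows "n \<in> carrier (Inn P)"
  using assms normal_imp_subgroup subgroup.subset by blast

lemma quot_map_eq_iff:
  assumes N: "N \<lhd> Inn P" and x: "x \<in> carrier P" and y: "y \<in> carrier P"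
  shows "quot_map P N x = quot_map P N y \<longleftrightarrow> (\<exists>n\<in>N. y = n x)"
proof
  assume "quot_map P N x = quot_map P N y"
  then show "\<exists>n\<in>N. y = n x" using quot_map_self[OF N y] mem_quot_map by metis
next
  assume "\<exists>n\<in>N. y = n x"
  then show "quot_map P N x = quot_map P N y" using quot_map_eqI[OF N _ x] by metis
qed

text \<open>If \<open>y = n x\<close>, then \<open>\<phi> y\<close> is the image of
  \<open>\<phi> x\<close> under the conjugate of \<open>n\<close> by \<open>\<phi>\<close>, which
  normality keeps in \<open>N\<close>. Thus all of \<open>Inn P\<close> acts on the set of
  \<open>N\<close>-orbits.\<close>

lemma quot_map_Inn_cong:
  assumes N: "N \<lhd> Inn P" and \<phi>: "\<phi> \<in> carrier (Inn P)"
    and x: "x \<in> carrier P" and y: "y \<in> carrier P"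
    and eq: "quot_map P N x = quot_map P N y"
  shows "quot_map P N (\<phi> x) = quot_map P N (\<phi> y)"
proof -
  interpret I: group "Inn P" by (rule group_Inn)
  obtain n where n: "n \<in> N" "y = n x" using eq quot_map_eq_iff[OF N x y] by blast
  let ?c = "\<phi> \<otimes>\<^bsub>Inn P\<^esub> n \<otimes>\<^bsub>Inn P\<^esub> inv\<^bsub>Inn P\<^esub> \<phi>"
  have "?c \<in> N" using normal.inv_op_closed2[OF N \<phi> n(1)] .
  moreover have "\<phi> y = ?c (\<phi> x)"
    using \<phi> x n normal_Inn_closed[OF N n(1)] by (simp add: Inn_mult Inn_closed Inn_inv_left)
  ultimately show ?thesis
    using quot_map_eq_iff[OF N Inn_closed[OF \<phi> x] Inn_closed[OF \<phi> y]] by blast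
qed

lemma quandle_quot_quandle:
  assumes N: "N \<lhd> Inn P"
  shows "quandle (quot_quandle P N)"
proof
  fix X assume "X \<in> carrier (quot_quandle P N)"
  then obtain x where x: "x \<in> carrier P" "X = quot_map P N x"
    by (auto simp: carrier_quot_quandle)
  note ps = psym_quot_quandle[OF N x(1)]
  show "psym (quot_quandle P N) X X = X" using ps[OF x(1)] x psym_self by simp
  let ?s = "psym_perm P x"
  let ?i = "inv\<^bsub>Inn P\<^esub> ?s"
  have s: "?s \<in> carrier (Inn P)" by (rule psym_perm_Inn[OF x(1)])
  have i: "?i \<in> carrier (Inn P)" using s by (simp add: group.inv_closed group_Inn)
  show "bij_betw (psym (quot_quandle P N) X) (carrier (quot_quandle P N)) (carrier (quot_quandle P N))"
  proof (rule bij_betw_imageI)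
    show "inj_on (psym (quot_quandle P N) X) (carrier (quot_quandle P N))"
    proof (rule inj_onI)
      fix Y Z assume "Y \<in> carrier (quot_quandle P N)" "Z \<in> carrier (quot_quandle P N)"
        and eq: "psym (quot_quandle P N) X Y = psym (quot_quandle P N) X Z"
      then obtain y z where yz: "y \<in> carrier P" "Y = quot_map P N y" "z \<in> carrier P" "Z = quot_map P N z"
        by (auto simp: carrier_quot_quandle)
      have "quot_map P N (?s y) = quot_map P N (?s z)"
        using eq ps yz x by (simp add: psym_perm_apply)
      \<comment> \<open>The inverse of s_x also acts on orbits, so it can be applied to both sides
        of the equation to cancel s_x.\<close>
      from quot_map_Inn_cong[OF N i Inn_closed[OF s yz(1)] Inn_closed[OF s yz(3)] this]
      show "Y = Z" using yz s by (simp add: Inn_inv_left)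
    qed
    show "psym (quot_quandle P N) X ` carrier (quot_quandle P N) = carrier (quot_quandle P N)"
    proof
      show "psym (quot_quandle P N) X ` carrier (quot_quandle P N) \<subseteq> carrier (quot_quandle P N)"
        using x ps psym_closed by (auto simp: carrier_quot_quandle)
      show "carrier (quot_quandle P N) \<subseteq> psym (quot_quandle P N) X ` carrier (quot_quandle P N)"
      proof
        fix Y assume "Y \<in> carrier (quot_quandle P N)"
        then obtain y where y: "y \<in> carrier P" "Y = quot_map P N y"
          by (auto simp: carrier_quot_quandle)
        \<comment> \<open>The preimage of the orbit of \<open>y\<close> is the orbit of its image
          under the inverse of s_x.\<close>
        have c: "?i y \<in> carrier P" by (rule Inn_closed[OF i y(1)])
        have "psym P x (?i y) = y" using Inn_inv_right[OF s y(1)] c by (simp add: psym_perm_apply)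
        then have "Y = psym (quot_quandle P N) X (quot_map P N (?i y))"
          using ps[OF c] x y by simp
        then show "Y \<in> psym (quot_quandle P N) X ` carrier (quot_quandle P N)"
          using c by (auto simp: carrier_quot_quandle)
      qed
    qed
  qed
next
  fix X Y Z
  assume "X \<in> carrier (quot_quandle P N)" "Y \<in> carrier (quot_quandle P N)" "Z \<in> carrier (quot_quandle P N)"
  then show "psym (quot_quandle P N) X (psym (quot_quandle P N) Y Z)
    = psym (quot_quandle P N) (psym (quot_quandle P N) X Y) (psym (quot_quandle P N) X Z)"
    by (auto simp: carrier_quot_quandle psym_quot_quandle[OF N] psym_closed psym_distrib[symmetric])
qed

lemma quandle_hom_quot_map:
  assumes "N \<lhd> Inn P"
  shows "quandle_hom P (quot_quandle P N) (quot_map P N)"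
  by (intro quandle_hom.intro quandle_axioms quandle_quot_quandle[OF assms] quandle_hom_axioms.intro)
    (auto simp: carrier_quot_quandle psym_quot_quandle[OF assms])

text \<open>The fibers of the quotient map are the \<open>N\<close>-orbits. Every \<open>n\<close>
  in \<open>N\<close> maps each orbit to itself and so lies in the kernel \<open>Inn_rel\<close>;
  since \<open>N\<close> is transitive on its orbits, so is that kernel on the fibers.\<close>

lemma connected_hom_quot_map:
  assumes N: "N \<lhd> Inn P"
  shows "connected_hom P (quot_quandle P N) (quot_map P N)"
proof -
  interpret pi: quandle_hom P "quot_quandle P N" "quot_map P N"
    by (rule quandle_hom_quot_map[OF N])
  have "\<exists>\<phi>\<in>Inn_rel P (quot_quandle P N) (quot_map P N). \<phi> x = y"
    if x: "x \<in> carrier P" and y: "y \<in> carrier P" and eq: "quot_map P N x = quot_map P N y" for x y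
  proof -
    obtain n where n: "n \<in> N" "y = n x" using eq quot_map_eq_iff[OF N x y] by blast
    have "n \<in> Inn_rel P (quot_quandle P N) (quot_map P N)"
      using quot_map_eqI[OF N n(1)] normal_Inn_closed[OF N n(1)]
      by (simp add: pi.Inn_rel_iff carrier_quot_quandle)
    then show ?thesis using n(2) by blast
  qed
  then show ?thesis
    unfolding connected_hom_def carrier_quot_quandle
    using pi.quandle_hom_axioms by blast
qed

text \<open>The operator \<open>the_elem\<close> has a meaningful value only on a singleton;
  invariance along the orbit of \<open>x\<close> makes its image the singleton of
  \<open>f x\<close>.\<close>

lemma quot_induced_quot_map:
  assumes "N \<lhd> Inn P" and "\<And>n. n \<in> N \<Longrightarrow> f (n x) = f x" and "x \<in> carrier P"
  shows "quot_induced f (quot_map P N x) = f x"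
proof -
  have "\<forall>z\<in>quot_map P N x. f z = f x"
    using assms(2) by (auto simp: mem_quot_map)
  then have "f ` quot_map P N x = {f x}"
    using quot_map_self[OF assms(1,3)] by blast
  then show ?thesis by (simp add: quot_induced_def)
qed

end

section \<open>Descent of homomorphisms to the quotient\<close>

context quandle_hom
begin

lemma quandle_hom_quot_induced:
  assumes N: "N \<lhd> Inn P" and inv: "\<And>n x. \<lbrakk>n \<in> N; x \<in> carrier P\<rbrakk> \<Longrightarrow> f (n x) = f x"
  shows "quandle_hom (quot_quandle P N) Q (quot_induced f)"
proof -
  have "quot_induced f (quot_map P N x) = f x" if "x \<in> carrier P" for x
    using dom.quot_induced_quot_map[OF N _ that] inv that by blast
  then show ?thesis
    by (intro quandle_hom.intro dom.quandle_quot_quandle[OF N] cod.quandle_axioms quandle_hom_axioms.intro)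
      (auto simp: carrier_quot_quandle dom.psym_quot_quandle[OF N] hom_closed hom_psym dom.psym_closed)
qed

text \<open>Provides the extensional representative of a homomorphism, for use where uniqueness as a
  HOL function is wanted.\<close>

lemma quandle_hom_restrict: "quandle_hom P Q (restrict f (carrier P))"
  by (intro quandle_hom.intro dom.quandle_axioms cod.quandle_axioms quandle_hom_axioms.intro)
    (auto simp: hom_closed hom_psym dom.psym_closed)

text \<open>Two maps occur: \<open>g\<close> determines the group, while \<open>f\<close> is the map
  shown to be invariant under it. For a generator built from \<open>a\<close> and \<open>b\<close>,
  put \<open>?y\<close> for the image of \<open>z\<close> under the inverse of s_b. The symmetries
  at \<open>f a\<close> and \<open>f b\<close> agree, so s_a and s_b send \<open>?y\<close> to
  points with the same value of \<open>f\<close>, and the second of these points is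
  \<open>z\<close>.\<close>

lemma Trans_rel_invariant:
  assumes cov: "\<And>x y. \<lbrakk>x \<in> carrier P; y \<in> carrier P; g x = g y\<rbrakk>
      \<Longrightarrow> psym_perm Q (f x) = psym_perm Q (f y)"
    and n: "n \<in> Trans_rel P g" and x: "x \<in> carrier P"
  shows "f (n x) = f x"
proof -
  interpret I: group "Inn P" by (rule dom.group_Inn)
  have gen: "f ((psym_perm P a \<otimes>\<^bsub>Inn P\<^esub> inv\<^bsub>Inn P\<^esub> (psym_perm P b)) z) = f z"
    if a: "a \<in> carrier P" and b: "b \<in> carrier P" and ab: "g a = g b" and z: "z \<in> carrier P" for a b z
  proof -
    let ?y = "(inv\<^bsub>Inn P\<^esub> (psym_perm P b)) z"
    have y: "?y \<in> carrier P" using b z by (simp add: dom.Inn_closed dom.psym_perm_Inn)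
    have "psym Q (f a) (f ?y) = psym Q (f b) (f ?y)"
      using cov[OF a b ab] cod.psym_perm_apply[OF hom_closed[OF y]] by metis
    then have "f (psym_perm P a ?y) = f (psym_perm P b ?y)"
      using a b y by (simp add: dom.psym_perm_apply hom_psym)
    then show ?thesis
      using a b z by (simp add: dom.Inn_mult dom.psym_perm_Inn dom.Inn_inv_right)
  qed
  have "n \<in> carrier (Inn P) \<and> (\<forall>x\<in>carrier P. f (n x) = f x)"
    using n unfolding Trans_rel_def
  proof (induction rule: generate.induct)
    case one
    then show ?case by (simp add: dom.Inn_one)
  next
    case (incl h)
    then show ?case using gen dom.psym_perm_Inn by auto
  next
    case (inv h)
    then obtain a b where ab: "a \<in> carrier P" "b \<in> carrier P" "g b = g a"
      and h: "h = psym_perm P a \<otimes>\<^bsub>Inn P\<^esub> inv\<^bsub>Inn P\<^esub> (psym_perm P b)"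
      by auto
    \<comment> \<open>The inverse of a generator is the generator with \<open>a\<close> and
      \<open>b\<close> exchanged.\<close>
    have "inv\<^bsub>Inn P\<^esub> h = psym_perm P b \<otimes>\<^bsub>Inn P\<^esub> inv\<^bsub>Inn P\<^esub> (psym_perm P a)"
      using ab dom.psym_perm_Inn by (simp add: h I.inv_mult_group)
    then show ?case using gen[OF ab(2,1,3)] ab dom.psym_perm_Inn by simp
  next
    case (eng h1 h2)
    then show ?case by (simp add: dom.Inn_mult dom.Inn_closed)
  qed
  then show ?thesis using x by blast
qed

section \<open>Factorization of \<open>f\<close> through the quotient by
  \<open>Trans_rel P f\<close>\<close>

lemma quot_map_Trans_rel_psym:
  assumes surj: "f ` carrier P = carrier Q"
    and x: "x \<in> carrier P" and y: "y \<in> carrier P" and z: "z \<in> carrier P" and eq: "f x = f y"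
  shows "quot_map P (Trans_rel P f) (psym P x z) = quot_map P (Trans_rel P f) (psym P y z)"
proof -
  interpret I: group "Inn P" by (rule dom.group_Inn)
  let ?n = "psym_perm P x \<otimes>\<^bsub>Inn P\<^esub> inv\<^bsub>Inn P\<^esub> (psym_perm P y)"
  have "?n \<in> Trans_rel P f"
    unfolding Trans_rel_def using x y eq by (intro generate.incl) blast
  \<comment> \<open>Inserting s_y followed by its inverse before s_x exhibits the two points as
    differing by a generator.\<close>
  moreover have "psym P x z = ?n (psym P y z)"
    using x y z dom.Inn_inv_left[OF dom.psym_perm_Inn[OF y] z]
    by (simp add: dom.Inn_mult dom.psym_perm_Inn dom.psym_closed dom.psym_perm_apply)
  ultimately show ?thesis
    using dom.quot_map_eqI[OF Trans_rel_normal[OF surj] _ dom.psym_closed[OF y z]] by metis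
qed

lemma quot_induced_Trans_rel:
  assumes surj: "f ` carrier P = carrier Q" and x: "x \<in> carrier P"
  shows "quot_induced f (quot_map P (Trans_rel P f) x) = f x"
  using Trans_rel_subset_Inn_rel[OF surj] x
  by (intro dom.quot_induced_quot_map[OF Trans_rel_normal[OF surj]])
    (auto simp: subset_iff Inn_rel_iff[OF surj])

lemma covering_hom_quot_induced:
  assumes surj: "f ` carrier P = carrier Q"
  shows "covering_hom (quot_quandle P (Trans_rel P f)) Q (quot_induced f)"
  unfolding covering_hom_def
proof (intro conjI ballI impI)
  let ?N = "Trans_rel P f"
  note N = Trans_rel_normal[OF surj]
  show "quandle_hom (quot_quandle P ?N) Q (quot_induced f)"
    using Trans_rel_subset_Inn_rel[OF surj]
    by (intro quandle_hom_quot_induced[OF N]) (auto simp: subset_iff Inn_rel_iff[OF surj])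
  show "quot_induced f ` carrier (quot_quandle P ?N) = carrier Q"
    by (simp add: carrier_quot_quandle image_image quot_induced_Trans_rel[OF surj] surj)
  fix X Y assume "X \<in> carrier (quot_quandle P ?N)" "Y \<in> carrier (quot_quandle P ?N)"
    and eq: "quot_induced f X = quot_induced f Y"
  then obtain x y where xy: "x \<in> carrier P" "X = quot_map P ?N x" "y \<in> carrier P" "Y = quot_map P ?N y"
    by (auto simp: carrier_quot_quandle)
  then have "quot_map P ?N (psym P x z) = quot_map P ?N (psym P y z)" if "z \<in> carrier P" for z
    using that eq quot_map_Trans_rel_psym[OF surj, of x y z]
    by (simp add: quot_induced_Trans_rel[OF surj])
  then show "psym_perm (quot_quandle P ?N) X = psym_perm (quot_quandle P ?N) Y"
    using xy unfolding psym_perm_def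
    by (intro restrict_ext) (auto simp: carrier_quot_quandle dom.psym_quot_quandle[OF N])
qed

text \<open>The quotient map is onto the set of orbits, so \<open>u\<close> is forced to send the
  orbit of \<open>x\<close> to \<open>\<pi> x\<close>. Membership in \<open>extensional\<close>
  fixes the values outside the set of orbits, where the other conditions say nothing.\<close>

lemma covering_factorization_ex1:
  assumes surj: "f ` carrier P = carrier Q"
    and \<pi>: "quandle_hom P R \<pi>" and h: "covering_hom R Q h"
    and fac: "\<And>x. x \<in> carrier P \<Longrightarrow> f x = h (\<pi> x)"
  defines "N \<equiv> Trans_rel P f"
  shows "\<exists>!u. u \<in> extensional (carrier (quot_quandle P N))
    \<and> quandle_hom (quot_quandle P N) R u
    \<and> (\<forall>x\<in>carrier P. \<pi> x = u (quot_map P N x))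
    \<and> (\<forall>X\<in>carrier (quot_quandle P N). quot_induced f X = h (u X))"
proof (rule ex1I)
  interpret pi: quandle_hom P R \<pi> by (rule \<pi>)
  have N: "N \<lhd> Inn P" unfolding N_def by (rule Trans_rel_normal[OF surj])
  \<comment> \<open>If \<open>f x = f y\<close>, then \<open>h\<close> identifies
    \<open>\<pi> x\<close> and \<open>\<pi> y\<close>, and the covering property makes their
    symmetries equal.\<close>
  have inv: "\<pi> (n x) = \<pi> x" if "n \<in> N" "x \<in> carrier P" for n x
    using that fac h pi.hom_closed unfolding N_def covering_hom_def
    by (intro pi.Trans_rel_invariant[of f]) auto
  have ind: "quot_induced \<pi> (quot_map P N x) = \<pi> x" if "x \<in> carrier P" for x
    using dom.quot_induced_quot_map[OF N] inv that by blast
  let ?u = "restrict (quot_induced \<pi>) (carrier (quot_quandle P N))"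
  have "quandle_hom (quot_quandle P N) R ?u"
    using inv by (intro quandle_hom.quandle_hom_restrict pi.quandle_hom_quot_induced[OF N])
  then show "?u \<in> extensional (carrier (quot_quandle P N))
    \<and> quandle_hom (quot_quandle P N) R ?u
    \<and> (\<forall>x\<in>carrier P. \<pi> x = ?u (quot_map P N x))
    \<and> (\<forall>X\<in>carrier (quot_quandle P N). quot_induced f X = h (?u X))"
    \<comment> \<open>On the orbit of \<open>x\<close>, both sides of the last equation equal
      \<open>f x\<close>, since \<open>h (\<pi> x) = f x\<close>.\<close>
    using fac quot_induced_Trans_rel[OF surj]
    by (auto simp: carrier_quot_quandle ind N_def[symmetric])
  fix u assume u: "u \<in> extensional (carrier (quot_quandle P N))
    \<and> quandle_hom (quot_quandle P N) R u
    \<and> (\<forall>x\<in>carrier P. \<pi> x = u (quot_map P N x))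
    \<and> (\<forall>X\<in>carrier (quot_quandle P N). quot_induced f X = h (u X))"
  show "u = ?u"
    using u by (intro extensionalityI[of _ "carrier (quot_quandle P N)"])
      (auto simp: carrier_quot_quandle ind)
qed

end

theorem theorem0p3:
  fixes P :: "'a quandle" and Q :: "'b quandle" and f :: "'a \<Rightarrow> 'b"
    and N :: "('a \<Rightarrow> 'a) set"
  assumes "quandle_hom P Q f" and "f ` carrier P = carrier Q"
    and "N = Trans_rel P f"
  shows "(\<forall>x\<in>carrier P. f x = quot_induced f (quot_map P N x))
    \<and> connected_hom P (quot_quandle P N) (quot_map P N)
    \<and> covering_hom (quot_quandle P N) Q (quot_induced f)
    \<and> (\<forall>(R :: 'c quandle) \<pi> h.
         quandle_hom P R \<pi> \<and> covering_hom R Q h \<and> (\<forall>x\<in>carrier P. f x = h (\<pi> x))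
         \<longrightarrow> (\<exists>!u. u \<in> extensional (carrier (quot_quandle P N))
               \<and> quandle_hom (quot_quandle P N) R u
               \<and> (\<forall>x\<in>carrier P. \<pi> x = u (quot_map P N x))
               \<and> (\<forall>X\<in>carrier (quot_quandle P N). quot_induced f X = h (u X))))"
proof -
  interpret quandle_hom P Q f by (rule assms(1))
  note surj = assms(2)
  show ?thesis
    unfolding assms(3)
    using quot_induced_Trans_rel[OF surj] covering_hom_quot_induced[OF surj]
      dom.connected_hom_quot_map[OF Trans_rel_normal[OF surj]]
    by (intro conjI allI impI covering_factorization_ex1[OF surj]) auto
qed

end
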